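(* Fix $d\ge1$ and a modulus of continuity $\omega$. Then $\|M\|_{\operatorname{Op}(\omega)}$ on $\mathbb{R}^d$ has exactly the same value regardless of whether distances and the (uncentered) maximal operator are computed according to the $\ell_1$ norm or according to the $\ell_\infty$ norm.
   Context: For a norm $\|\cdot\|$ on $\mathbb{R}^d$ and a locally integrable $f:\mathbb{R}^d\to\mathbb{R}$, the uncentered Hardy-Littlewood maximal function is $Mf(x)=\sup_{B\ni x}\frac1{|B|}\int_B|f(y)|\,dy\in[0,\infty]$, the supremum being over all balls $B$ (of positive finite radius) with respect to $\|\cdot\|$ containing $x$; $|B|$ is Lebesgue measure. A modulus of continuity is a function $\omega:[0,\infty)\to[0,\infty)$ that is continuous, nondecreasing, subadditive, with $\omega(0)=0$, and not identically zero. For $f:\mathbb{R}^d\to\mathbb{R}$ let $\|f\|_{\operatorname{Lip}(\omega)}=\sup_{x\ne y}\frac{|f(x)-f(y)|}{\omega(\|x-y\|)}$; $\operatorname{Lip}(\omega)$ consists of the $f$ for which this is finite, and $$\|M\|_{\operatorname{Op}(\omega)}=\sup\Big\{\frac{\|Mf\|_{\operatorname{Lip}(\omega)}}{\|f\|_{\operatorname{Lip}(\omega)}}: f\in\operatorname{Lip}(\omega),\ \|f\|_{\operatorname{Lip}(\omega)}\ne0\Big\}.$$ The same norm $\|\cdot\|$ is used both for distances and for the balls defining $M$. If $Mf\equiv\infty$, it is regarded as constant, i.e. $\|Mf\|_{\operatorname{Lip}(\omega)}=0$. *)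

theory Defs
  imports "HOL-Analysis.Analysis"
begin

text \<open>
  A modulus of continuity is a function on the half-line \<open>[0,\<infinity>)\<close>; here it is a total function on
  the reals of which only the restriction to \<open>{0..}\<close> is ever used. Subadditivity and not vanishing
  identically force \<open>\<omega> t > 0\<close> for all \<open>t > 0\<close>, so the quotients below never divide by zero.
\<close>

definition modulus_of_continuity :: "(real \<Rightarrow> real) \<Rightarrow> bool" where
  "modulus_of_continuity \<omega> \<longleftrightarrow>
     continuous_on {0..} \<omega> \<and>
     mono_on {0..} \<omega> \<and>
     (\<forall>s\<ge>0. \<forall>t\<ge>0. \<omega> (s + t) \<le> \<omega> s + \<omega> t) \<and>
     (\<forall>t\<ge>0. \<omega> t \<ge> 0) \<and>
     \<omega> 0 = 0 \<and>
     (\<exists>t\<ge>0. \<omega> t \<noteq> 0)"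

text \<open>
  The norm is passed as an explicit function \<open>N\<close>, because the library norm on \<open>real ^ 'n\<close> is the
  Euclidean one. The \<open>\<ell>\<^sub>\<infinity>\<close> norm is the library's \<^const>\<open>infnorm\<close>.
\<close>

definition l1norm :: "real ^ 'n \<Rightarrow> real" where
  "l1norm x = (\<Sum>i\<in>UNIV. \<bar>x $ i\<bar>)"

definition norm_ball :: "(real ^ 'n \<Rightarrow> real) \<Rightarrow> real ^ 'n \<Rightarrow> real \<Rightarrow> (real ^ 'n) set" where
  "norm_ball N c r = {y. N (y - c) < r}"

definition maximal_function ::
  "(real ^ 'n \<Rightarrow> real) \<Rightarrow> (real ^ 'n \<Rightarrow> real) \<Rightarrow> real ^ 'n \<Rightarrow> ennreal" where
  "maximal_function N f x =
     (SUP B \<in> {norm_ball N c r | c r. 0 < r \<and> x \<in> norm_ball N c r}.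
        (\<integral>\<^sup>+y\<in>B. ennreal \<bar>f y\<bar> \<partial>lebesgue) / emeasure lebesgue B)"

definition lip_norm ::
  "(real ^ 'n \<Rightarrow> real) \<Rightarrow> (real \<Rightarrow> real) \<Rightarrow> (real ^ 'n \<Rightarrow> real) \<Rightarrow> ennreal" where
  "lip_norm N \<omega> f =
     (SUP (x, y) \<in> {(x, y). x \<noteq> y}. ennreal (\<bar>f x - f y\<bar> / \<omega> (N (x - y))))"

definition Lip ::
  "(real ^ 'n \<Rightarrow> real) \<Rightarrow> (real \<Rightarrow> real) \<Rightarrow> (real ^ 'n \<Rightarrow> real) set" where
  "Lip N \<omega> = {f. lip_norm N \<omega> f < \<infinity>}"

text \<open>
  Extension to functions with values in \<open>[0,\<infinity>]\<close>: the constant \<open>\<infinity>\<close> has norm \<open>0\<close>, and a function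
  taking both finite and infinite values has norm \<open>\<infinity>\<close>. The latter case does not arise for the
  maximal function of a member of \<open>Lip N \<omega>\<close>: translating a ball by \<open>h\<close> changes the average by at
  most \<open>lip_norm N \<omega> f * \<omega> (N h)\<close>.
\<close>

definition ext_lip_norm ::
  "(real ^ 'n \<Rightarrow> real) \<Rightarrow> (real \<Rightarrow> real) \<Rightarrow> (real ^ 'n \<Rightarrow> ennreal) \<Rightarrow> ennreal" where
  "ext_lip_norm N \<omega> g =
     (if \<forall>x. g x = \<infinity> then 0
      else if \<exists>x. g x = \<infinity> then \<infinity>
      else lip_norm N \<omega> (\<lambda>x. enn2real (g x)))"

definition maximal_op_norm :: "(real ^ 'n \<Rightarrow> real) \<Rightarrow> (real \<Rightarrow> real) \<Rightarrow> ennreal" where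
  "maximal_op_norm N \<omega> =
     (SUP f \<in> {f \<in> Lip N \<omega>. lip_norm N \<omega> f \<noteq> 0}.
        ext_lip_norm N \<omega> (maximal_function N f) / lip_norm N \<omega> f)"

end

theory Submission
  imports Defs
begin

text \<open>
  For every norm, a ball \<open>B = B(c, \<rho>)\<close> containing \<open>x\<close> is compared with \<open>B' = B(c + (h - r) v, \<rho> + r)\<close>, where
  \<open>h\<close> is the distance from \<open>x\<close> to \<open>y\<close>, \<open>v\<close> is the unit vector from \<open>c\<close> towards \<open>y\<close>, and \<open>h/2 \<le> r \<le> h\<close>; then
  \<open>y \<in> B'\<close>. Coupling both balls by the same uniform point \<open>z\<close> of the unit ball, the displacement
  \<open>(h - r) v + r z\<close> is uniform in \<open>B((h - r) v, r)\<close>. That ball contains a ball of radius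
  \<open>min t ((t + 2 r - h) / 2)\<close> inside \<open>B(0, t)\<close>, which bounds the distribution of the norm of the
  displacement, and hence \<open>Mf x - Mf y\<close>, independently of the norm.

  The bound is attained by \<open>f u = \<omega> h - \<omega> (min (N u) h)\<close> at \<open>0\<close> and \<open>h e\<close> as soon as there is a unit
  vector \<open>e\<close> for which the intersection of \<open>B(0, t)\<close> with \<open>B(h e, q)\<close> is itself a ball. Such a vector exists
  for both norms: a standard basis vector for \<open>\<ell>\<^sub>1\<close>, and the all-ones vector for \<open>\<ell>\<^sub>\<infinity>\<close>.
\<close>

section \<open>Layer cake formula\<close>

text \<open>Tonelli for the region \<open>0 < l \<le> X x\<close>. Negative values of
  \<open>X\<close> contribute 0 on both sides: \<open>ennreal\<close> truncates them, and
  \<open>{0<..X x}\<close> is then empty.\<close>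

lemma nn_integral_layer_cake:
  fixes X :: "'a \<Rightarrow> real"
  assumes "sigma_finite_measure M" and X[measurable]: "X \<in> borel_measurable M"
  shows "(\<integral>\<^sup>+x. ennreal (X x) \<partial>M) =
    (\<integral>\<^sup>+l\<in>{0<..}. emeasure M {x \<in> space M. l \<le> X x} \<partial>lborel)"
proof -
  interpret M: sigma_finite_measure M by fact
  interpret pair_sigma_finite M lborel
    by (simp add: pair_sigma_finite_def assms sigma_finite_lborel)
  have "ennreal (X x) = (\<integral>\<^sup>+l. indicator {0<..X x} l \<partial>lborel)" for x
    by (cases "0 \<le> X x") (auto simp: ennreal_neg)
  then have "(\<integral>\<^sup>+x. ennreal (X x) \<partial>M) = (\<integral>\<^sup>+x. (\<integral>\<^sup>+l. indicator {0<..X x} l \<partial>lborel) \<partial>M)"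
    by simp
  also have "\<dots> = (\<integral>\<^sup>+l. (\<integral>\<^sup>+x. indicator {0<..X x} l \<partial>M) \<partial>lborel)"
  proof (rule Fubini'[symmetric])
    have "(\<lambda>(x, l). indicator {0<..X x} l :: ennreal) =
      (\<lambda>p. if 0 < snd p \<and> snd p \<le> X (fst p) then 1 else 0)"
      by (auto simp: fun_eq_iff indicator_def)
    also have "\<dots> \<in> borel_measurable (M \<Otimes>\<^sub>M lborel)" by measurable
    finally show "(\<lambda>(x, l). indicator {0<..X x} l :: ennreal) \<in> borel_measurable (M \<Otimes>\<^sub>M lborel)" .
  qed
  also have "\<dots> = (\<integral>\<^sup>+l. emeasure M {x \<in> space M. l \<le> X x} * indicator {0<..} l \<partial>lborel)"
  proof (intro nn_integral_cong)
    fix l :: real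
    have "(\<integral>\<^sup>+x. indicator {0<..X x} l \<partial>M) =
      (\<integral>\<^sup>+x. indicator {0<..} l * indicator {x \<in> space M. l \<le> X x} x \<partial>M)"
      by (intro nn_integral_cong) (auto simp: indicator_def)
    also have "\<dots> = emeasure M {x \<in> space M. l \<le> X x} * indicator {0<..} l"
      by (subst nn_integral_cmult_indicator) (auto simp: mult.commute)
    finally show "(\<integral>\<^sup>+x. indicator {0<..X x} l \<partial>M) = \<dots>" .
  qed
  finally show ?thesis .
qed

section \<open>Moduli of continuity and their generalized inverses\<close>

lemma modulus_mono: "modulus_of_continuity \<omega> \<Longrightarrow> 0 \<le> s \<Longrightarrow> s \<le> t \<Longrightarrow> \<omega> s \<le> \<omega> t"
  by (auto simp: modulus_of_continuity_def mono_on_def)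

lemma modulus_nonneg: "modulus_of_continuity \<omega> \<Longrightarrow> 0 \<le> t \<Longrightarrow> 0 \<le> \<omega> t"
  by (auto simp: modulus_of_continuity_def)

lemma modulus_0: "modulus_of_continuity \<omega> \<Longrightarrow> \<omega> 0 = 0"
  by (auto simp: modulus_of_continuity_def)

text \<open>By subadditivity a zero at \<open>t\<close> would spread to all multiples of
  \<open>t\<close>, and by monotonicity to the whole half-line.\<close>

lemma modulus_pos:
  assumes m: "modulus_of_continuity \<omega>" and t: "0 < t"
  shows "0 < \<omega> t"
proof (rule ccontr)
  assume "\<not> 0 < \<omega> t"
  then have z: "\<omega> t = 0" using modulus_nonneg[OF m, of t] t by simp
  have sub: "\<omega> (a + b) \<le> \<omega> a + \<omega> b" if "0 \<le> a" "0 \<le> b" for a b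
    using m that by (auto simp: modulus_of_continuity_def)
  have n: "\<omega> (real n * t) \<le> 0" for n
  proof (induction n)
    case 0
    then show ?case by (simp add: modulus_0[OF m])
  next
    case (Suc n)
    then show ?case using sub[of "real n * t" t] t z by (simp add: algebra_simps)
  qed
  obtain s where s: "0 \<le> s" "\<omega> s \<noteq> 0" using m by (auto simp: modulus_of_continuity_def)
  obtain n where "s < real n * t" using t reals_Archimedean3 by blast
  then have "\<omega> s \<le> 0" using modulus_mono[OF m s(1), of "real n * t"] n[of n] by simp
  then show False using modulus_nonneg[OF m s(1)] s by simp
qed

lemma modulus_tendsto_0:
  assumes m: "modulus_of_continuity \<omega>" and \<epsilon>: "0 < \<epsilon>"
  obtains \<delta> where "0 < \<delta>" "\<And>t. 0 \<le> t \<Longrightarrow> t < \<delta> \<Longrightarrow> \<omega> t < \<epsilon>"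
proof -
  have "continuous_on {0..} \<omega>" using m by (auto simp: modulus_of_continuity_def)
  then obtain \<delta> where "0 < \<delta>" and d: "\<forall>x\<in>{0..}. dist x 0 < \<delta> \<longrightarrow> dist (\<omega> x) (\<omega> 0) < \<epsilon>"
    using \<epsilon> unfolding continuous_on_iff by (metis atLeast_iff order_refl)
  then have "\<omega> t < \<epsilon>" if "0 \<le> t" "t < \<delta>" for t
    using that modulus_0[OF m] by (force simp: dist_real_def)
  then show ?thesis using that \<open>0 < \<delta>\<close> by blast
qed

text \<open>The left-continuous generalized inverse, meaningful for levels \<open>l\<close> that
  \<open>\<omega>\<close> reaches.\<close>

definition modulus_inverse :: "(real \<Rightarrow> real) \<Rightarrow> real \<Rightarrow> real" where
  "modulus_inverse \<omega> l = Inf {t. 0 \<le> t \<and> l \<le> \<omega> t}"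

text \<open>Continuity of \<open>\<omega>\<close> makes the infimum attained, so the equivalence is
  exact. It turns an event \<open>l \<le> \<omega> T\<close> into \<open>t \<le> T\<close> inside
  the layer cake formula.\<close>

lemma modulus_inverse:
  assumes m: "modulus_of_continuity \<omega>" and h: "0 \<le> h" and l: "0 < l" "l \<le> \<omega> h"
  shows "0 < modulus_inverse \<omega> l" "modulus_inverse \<omega> l \<le> h"
    and "0 \<le> t \<Longrightarrow> l \<le> \<omega> t \<longleftrightarrow> modulus_inverse \<omega> l \<le> t"
proof -
  define S where "S = {t. 0 \<le> t \<and> l \<le> \<omega> t}"
  have c: "continuous_on {0..} \<omega>" using m by (auto simp: modulus_of_continuity_def)
  have "S = {0..} \<inter> \<omega> -` {l..}" by (auto simp: S_def)
  moreover have "closed \<dots>"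
    by (rule continuous_closed_preimage[OF c]) auto
  ultimately have "closed S" by simp
  have hS: "h \<in> S" using h l by (simp add: S_def)
  have bdd: "bdd_below S" by (auto simp: S_def bdd_below_def)
  have I: "Inf S \<in> S" using closed_contains_Inf[OF _ bdd \<open>closed S\<close>] hS by blast
  have e: "modulus_inverse \<omega> l = Inf S" by (simp add: modulus_inverse_def S_def)
  show "modulus_inverse \<omega> l \<le> h" unfolding e by (rule cInf_lower[OF hS bdd])
  have "Inf S \<noteq> 0" using I l modulus_0[OF m] by (auto simp: S_def)
  then show "0 < modulus_inverse \<omega> l" using I e by (auto simp: S_def)
  show "l \<le> \<omega> t \<longleftrightarrow> modulus_inverse \<omega> l \<le> t" if t: "0 \<le> t"
  proof
    assume "l \<le> \<omega> t"
    then show "modulus_inverse \<omega> l \<le> t" unfolding e using t by (intro cInf_lower bdd) (simp add: S_def)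
  next
    assume "modulus_inverse \<omega> l \<le> t"
    then have "\<omega> (Inf S) \<le> \<omega> t" using I by (intro modulus_mono[OF m]) (auto simp: e S_def)
    then show "l \<le> \<omega> t" using I by (auto simp: S_def)
  qed
qed

section \<open>The extremal constant\<close>

text \<open>
  The share, in a ball of radius \<open>r\<close> with center \<open>(h - r) v\<close>, of the largest ball inside it that is
  centered on the axis spanned by \<open>v\<close> and contained in the ball of radius \<open>t\<close> around the origin.
\<close>

definition overlap_fraction :: "nat \<Rightarrow> real \<Rightarrow> real \<Rightarrow> real \<Rightarrow> real" where
  "overlap_fraction d h r t = (min t ((t + 2 * r - h) / 2) / r) ^ d"

text \<open>
  The mean of \<open>\<omega> T\<close>, by the layer cake formula, for \<open>T\<close> with distribution function
  \<open>overlap_fraction d h r\<close> on \<open>[0, h]\<close>.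
\<close>

definition mean_displacement :: "nat \<Rightarrow> (real \<Rightarrow> real) \<Rightarrow> real \<Rightarrow> real \<Rightarrow> ennreal" where
  "mean_displacement d \<omega> h r =
     (\<integral>\<^sup>+l\<in>{0<..\<omega> h}. ennreal (1 - overlap_fraction d h r (modulus_inverse \<omega> l)) \<partial>lborel)"

lemma mean_displacement_le:
  assumes "0 \<le> r" "r \<le> h" "h / 2 \<le> r" "modulus_of_continuity \<omega>"
  shows "mean_displacement d \<omega> h r \<le> ennreal (\<omega> h)"
proof -
  have h: "0 \<le> h" using assms by simp
  have "mean_displacement d \<omega> h r \<le> (\<integral>\<^sup>+l. indicator {0<..\<omega> h} l \<partial>lborel)"
    unfolding mean_displacement_def
  proof (intro nn_integral_mono)
    fix l
    show "ennreal (1 - overlap_fraction d h r (modulus_inverse \<omega> l)) * indicator {0<..\<omega> h} l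
      \<le> indicator {0<..\<omega> h} l"
    proof (cases "l \<in> {0<..\<omega> h}")
      case True
      then have "0 < modulus_inverse \<omega> l"
        using modulus_inverse(1)[OF assms(4) h] by simp
      \<comment> \<open>From \<open>h / 2 \<le> r\<close> follows
        \<open>t + 2 r - h \<ge> t > 0\<close>, so the base of the power is nonnegative.\<close>
      then have "0 \<le> overlap_fraction d h r (modulus_inverse \<omega> l)"
        using assms by (simp add: overlap_fraction_def)
      then show ?thesis by (simp add: indicator_def ennreal_le_1)
    qed simp
  qed
  also have "\<dots> = ennreal (\<omega> h)"
    using modulus_nonneg[OF assms(4) h] by simp
  finally show ?thesis .
qed

lemma modulus_diff_le:
  assumes m: "modulus_of_continuity \<omega>" and "0 \<le> a" "0 \<le> b"
  shows "\<bar>\<omega> a - \<omega> b\<bar> \<le> \<omega> \<bar>a - b\<bar>"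
proof -
  have *: "\<bar>\<omega> a - \<omega> b\<bar> \<le> \<omega> \<bar>a - b\<bar>" if "0 \<le> a" "a \<le> b" for a b
  proof -
    have "\<omega> (a + (b - a)) \<le> \<omega> a + \<omega> (b - a)"
      using m that unfolding modulus_of_continuity_def by (metis diff_ge_0_iff_ge)
    then show ?thesis using modulus_mono[OF m that] that by simp
  qed
  show ?thesis
    using *[of a b] *[of b a] assms by (cases "a \<le> b") (simp_all add: abs_minus_commute)
qed

text \<open>The infimum optimizes the radius increase \<open>r\<close> in the coupling, the supremum
  runs over the distances \<open>h\<close> of two points. Only the dimension and
  \<open>\<omega>\<close> enter, so it can serve as the common value for different norms.\<close>

definition extremal_const :: "nat \<Rightarrow> (real \<Rightarrow> real) \<Rightarrow> ennreal" where
  "extremal_const d \<omega> =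
     (SUP h\<in>{0<..}. (INF r\<in>{h / 2..h}. mean_displacement d \<omega> h r) / ennreal (\<omega> h))"

lemma INF_mean_displacement_finite:
  assumes m: "modulus_of_continuity \<omega>" and h: "0 < h"
  obtains D where "0 \<le> D" "(INF r\<in>{h / 2..h}. mean_displacement d \<omega> h r) = ennreal D"
proof -
  have "(INF r\<in>{h / 2..h}. mean_displacement d \<omega> h r) \<le> ennreal (\<omega> h)"
    using h by (intro INF_lower2[of h] mean_displacement_le m) auto
  then show ?thesis using that by (metis ennreal_cases ennreal_neq_top top_unique)
qed

section \<open>Norms and their balls\<close>

text \<open>The last two assumptions are equivalence with the Euclidean norm: \<open>le_norm\<close>
  yields continuity of \<open>N\<close>, while \<open>norm_le\<close> yields definiteness and
  bounded balls.\<close>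

locale vector_norm =
  fixes N :: "real ^ 'n \<Rightarrow> real"
  assumes triangle: "N (x + y) \<le> N x + N y"
    and scale: "N (a *\<^sub>R x) = \<bar>a\<bar> * N x"
    and le_norm: "\<exists>C. \<forall>x. N x \<le> C * norm x"
    and norm_le: "\<exists>C. \<forall>x. norm x \<le> C * N x"
begin

lemma N_0[simp]: "N 0 = 0"
  using scale[of 0 0] by simp

lemma N_minus[simp]: "N (- x) = N x"
  using scale[of "-1" x] by simp

lemma minus_commute: "N (x - y) = N (y - x)"
  using N_minus[of "x - y"] by simp

lemma nonneg[simp]: "0 \<le> N x"
  using triangle[of x "- x"] by simp

lemma triangle_diff: "N (x - z) \<le> N (x - y) + N (y - z)"
  using triangle[of "x - y" "y - z"] by simp

lemma reverse_triangle: "\<bar>N x - N y\<bar> \<le> N (x - y)"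
  using triangle[of "x - y" y] triangle[of "y - x" x] minus_commute[of x y] by simp

lemma eq_0_iff[simp]: "N x = 0 \<longleftrightarrow> x = 0"
proof -
  obtain C where "norm x \<le> C * N x" using norm_le by blast
  then show ?thesis by auto
qed

lemma pos_iff[simp]: "0 < N x \<longleftrightarrow> x \<noteq> 0"
  using nonneg[of x] eq_0_iff[of x] by linarith

lemma small_near:
  assumes "0 < \<delta>"
  obtains \<eta> where "0 < \<eta>" "\<And>x y. dist x y < \<eta> \<Longrightarrow> N (x - y) < \<delta>"
proof -
  obtain C where C: "\<And>x. N x \<le> C * norm x" using le_norm by blast
  have "N x \<le> max C 1 * norm x" for x
    using C[of x] mult_right_mono[of C "max C 1" "norm x"] by simp
  moreover have "max C 1 * norm x < \<delta>" if "norm x < \<delta> / max C 1" for x :: "real ^ 'n"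
    using that by (simp add: pos_less_divide_eq mult.commute)
  ultimately show ?thesis
  proof (intro that[of "\<delta> / max C 1"])
    show "0 < \<delta> / max C 1" using assms by simp
  qed (metis dist_norm le_less_trans)
qed

lemma continuous_on_N: "continuous_on A N"
  unfolding continuous_on_iff
proof (intro ballI allI impI)
  fix x \<epsilon> assume "0 < (\<epsilon>::real)"
  then obtain \<eta> where "0 < \<eta>" "\<And>x y. dist x y < \<eta> \<Longrightarrow> N (x - y) < \<epsilon>" using small_near by metis
  then show "\<exists>d>0. \<forall>x'\<in>A. dist x' x < d \<longrightarrow> dist (N x') (N x) < \<epsilon>"
    unfolding dist_real_def using reverse_triangle by (meson le_less_trans)
qed

lemma N_borel[measurable]: "N \<in> borel_measurable borel"
  using continuous_on_N by (rule borel_measurable_continuous_onI)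

lemma ball_borel[measurable]: "norm_ball N c r \<in> sets borel"
  unfolding norm_ball_def by measurable

lemma ball_open: "open (norm_ball N c r)"
  unfolding norm_ball_def
  by (intro open_Collect_less continuous_on_compose2[OF continuous_on_N[of UNIV]] continuous_intros) auto

lemma emeasure_unit_ball:
  "emeasure lborel (norm_ball N 0 1) \<noteq> 0" "emeasure lborel (norm_ball N 0 1) \<noteq> \<infinity>"
proof -
  show "emeasure lborel (norm_ball N 0 1) \<noteq> 0"
  proof
    assume "emeasure lborel (norm_ball N 0 1) = 0"
    then have "norm_ball N 0 1 \<in> null_sets lborel" by (auto simp: null_sets_def)
    then have "negligible (norm_ball N 0 1)"
      by (metis completion.complete2 negligible_iff_null_sets null_sets_completionI)
    then have "norm_ball N 0 1 = {}" using open_not_negligible[OF ball_open[of 0 1]] by blast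
    moreover have "0 \<in> norm_ball N 0 1" by (simp add: norm_ball_def)
    ultimately show False by simp
  qed
  obtain C where C: "\<And>x. norm x \<le> C * N x" using norm_le by blast
  have "norm x \<le> \<bar>C\<bar>" if "N x < 1" for x
  proof -
    have "C * N x \<le> \<bar>C\<bar> * 1" using that by (intro mult_mono) auto
    then show ?thesis using C[of x] by simp
  qed
  then have "norm_ball N 0 1 \<subseteq> cball 0 \<bar>C\<bar>" by (auto simp: norm_ball_def)
  then have "bounded (norm_ball N 0 1)" using bounded_subset bounded_cball by blast
  then show "emeasure lborel (norm_ball N 0 1) \<noteq> \<infinity>"
    using emeasure_bounded_finite by force
qed

section \<open>The uniform measure on the unit ball\<close>

text \<open>Each ball is the image of the unit ball under some \<open>z \<mapsto> c + r z\<close>.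
  Averages over all balls thus become expectations under one measure, which makes a coupling a
  pointwise comparison at the same \<open>z\<close>.\<close>

definition unif :: "(real ^ 'n) measure" where
  "unif = uniform_measure lborel (norm_ball N 0 1)"

lemma space_unif[simp]: "space unif = UNIV" and sets_unif[simp, measurable_cong]: "sets unif = sets borel"
  by (simp_all add: unif_def)

lemma emeasure_unif_UNIV[simp]: "emeasure unif UNIV = 1"
  using emeasure_unit_ball unfolding unif_def
  by (subst emeasure_uniform_measure) (auto simp: less_top)

lemma sigma_finite_unif: "sigma_finite_measure unif"
  by (rule finite_measure.axioms(1)) (auto intro!: finite_measureI)

lemma nn_integral_affine:
  fixes c :: "real ^ 'n"
  assumes [measurable]: "g \<in> borel_measurable borel" and r: "0 < r"
  shows "(\<integral>\<^sup>+y. g y \<partial>lborel) = ennreal (r ^ CARD('n)) * (\<integral>\<^sup>+z. g (c + r *\<^sub>R z) \<partial>lborel)"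
proof -
  have "(\<integral>\<^sup>+y. g y \<partial>lborel) =
    (\<integral>\<^sup>+y. g y \<partial>density (distr lborel borel (\<lambda>x. c + r *\<^sub>R x)) (\<lambda>_. \<bar>r\<bar> ^ DIM(real ^ 'n)))"
    using r by (subst lborel_affine[of r c]) auto
  also have "\<dots> = ennreal (r ^ CARD('n)) * (\<integral>\<^sup>+z. g (c + r *\<^sub>R z) \<partial>lborel)"
    using r by (simp add: nn_integral_density nn_integral_distr nn_integral_cmult)
  finally show ?thesis .
qed

lemma nn_integral_ball:
  assumes [measurable]: "g \<in> borel_measurable borel" and r: "0 < r"
  shows "(\<integral>\<^sup>+y\<in>norm_ball N c r. g y \<partial>lborel) =
    ennreal (r ^ CARD('n)) * (\<integral>\<^sup>+z\<in>norm_ball N 0 1. g (c + r *\<^sub>R z) \<partial>lborel)"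
proof -
  have "indicator (norm_ball N c r) (c + r *\<^sub>R z) = (indicator (norm_ball N 0 1) z :: ennreal)" for z
    using r by (auto simp: norm_ball_def scale indicator_def)
  then show ?thesis
    by (subst nn_integral_affine[OF _ r, of _ c]) simp_all
qed

lemma emeasure_ball:
  assumes r: "0 < r"
  shows "emeasure lborel (norm_ball N c r) =
    ennreal (r ^ CARD('n)) * emeasure lborel (norm_ball N 0 1)"
  using nn_integral_ball[OF _ r, of "\<lambda>_. 1" c] by simp

text \<open>The affine substitution multiplies numerator and denominator by the same factor
  \<open>r ^ CARD('n)\<close>.\<close>

lemma average_eq:
  assumes g[measurable]: "g \<in> borel_measurable borel" and r: "0 < r"
  shows "(\<integral>\<^sup>+y\<in>norm_ball N c r. g y \<partial>lebesgue) / emeasure lebesgue (norm_ball N c r) =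
    (\<integral>\<^sup>+z. g (c + r *\<^sub>R z) \<partial>unif)"
proof -
  have "(\<integral>\<^sup>+y\<in>norm_ball N c r. g y \<partial>lebesgue) / emeasure lebesgue (norm_ball N c r) =
    (ennreal (r ^ CARD('n)) * (\<integral>\<^sup>+z\<in>norm_ball N 0 1. g (c + r *\<^sub>R z) \<partial>lborel)) /
    (ennreal (r ^ CARD('n)) * emeasure lborel (norm_ball N 0 1))"
    by (simp add: nn_integral_completion nn_integral_ball[OF g r] emeasure_ball[OF r])
  also have "\<dots> = (\<integral>\<^sup>+z\<in>norm_ball N 0 1. g (c + r *\<^sub>R z) \<partial>lborel) / emeasure lborel (norm_ball N 0 1)"
    using r by (subst (1 2) mult.commute) (auto intro!: divide_mult_eq)
  also have "\<dots> = (\<integral>\<^sup>+z. g (c + r *\<^sub>R z) \<partial>unif)"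
    unfolding unif_def by (rule nn_integral_uniform_measure[symmetric]) auto
  finally show ?thesis .
qed

text \<open>The equality serves the upper bound on the operator norm, the inequality serves the
  lower bound.\<close>

lemma emeasure_unif_ball:
  assumes q: "0 < q"
  shows "norm_ball N c q \<subseteq> norm_ball N 0 1 \<Longrightarrow> emeasure unif (norm_ball N c q) = ennreal (q ^ CARD('n))"
    and "emeasure unif (norm_ball N c q) \<le> ennreal (q ^ CARD('n))"
proof -
  have e: "emeasure unif (norm_ball N c q) =
      emeasure lborel (norm_ball N 0 1 \<inter> norm_ball N c q) / emeasure lborel (norm_ball N 0 1)"
    unfolding unif_def by (rule emeasure_uniform_measure) auto
  have d: "emeasure lborel (norm_ball N c q) / emeasure lborel (norm_ball N 0 1) = ennreal (q ^ CARD('n))"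
    using emeasure_unit_ball unfolding emeasure_ball[OF q]
    by (simp add: ennreal_mult_divide_eq)
  show "emeasure unif (norm_ball N c q) = ennreal (q ^ CARD('n))" if "norm_ball N c q \<subseteq> norm_ball N 0 1"
    using that d unfolding e by (simp add: Int_absorb1)
  show "emeasure unif (norm_ball N c q) \<le> ennreal (q ^ CARD('n))"
    unfolding e d[symmetric] by (intro divide_right_mono_ennreal emeasure_mono) auto
qed

lemma emeasure_unif_Collect_ge:
  assumes [measurable]: "X \<in> borel_measurable borel"
  shows "emeasure unif {z. (t::real) \<le> X z} = 1 - emeasure unif {z. X z < t}"
proof -
  interpret finite_measure unif by (rule finite_measureI) simp
  have "{z. t \<le> X z} = space unif - {z. X z < t}" by auto
  then show ?thesis using emeasure_compl[of "{z. X z < t}" unif] by auto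
qed

lemma modulus_N_continuous:
  assumes "modulus_of_continuity \<omega>"
  shows "continuous_on A (\<lambda>x. \<omega> (N x))"
    and "0 \<le> h \<Longrightarrow> continuous_on A (\<lambda>x. \<omega> (min (N x) h))"
proof -
  have c: "continuous_on {0..} \<omega>" using assms by (auto simp: modulus_of_continuity_def)
  show "continuous_on A (\<lambda>x. \<omega> (N x))"
    by (rule continuous_on_compose2[OF c continuous_on_N]) auto
  show "continuous_on A (\<lambda>x. \<omega> (min (N x) h))" if "0 \<le> h"
    using that by (intro continuous_on_compose2[OF c] continuous_on_min continuous_on_N continuous_on_const) auto
qed

lemma AE_unif: "AE z in unif. N z < 1"
proof -
  have "AE z in unif. z \<in> norm_ball N 0 1"
    unfolding unif_def by (rule AE_uniform_measureI) auto
  then show ?thesis by (simp add: norm_ball_def)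
qed

lemma emeasure_unif_mono:
  assumes "B \<in> sets borel" "\<And>z. z \<in> A \<Longrightarrow> N z < 1 \<Longrightarrow> z \<in> B"
  shows "emeasure unif A \<le> emeasure unif B"
  using AE_unif assms by (intro emeasure_mono_AE) auto

section \<open>The upper bound, for every norm\<close>

text \<open>The ball of radius \<open>\<rho>\<close> around \<open>m v\<close> lies in
  \<open>B(0, t)\<close> because \<open>m + \<rho> = t\<close>, and in the range of the displacement
  because \<open>\<rho> + (h - r) - m \<le> r\<close>.\<close>

lemma overlap_fraction_le:
  assumes h: "0 < t" "t \<le> h" "h / 2 \<le> r" "r \<le> h" and v: "N v = 1"
  shows "ennreal (overlap_fraction CARD('n) h r t) \<le> emeasure unif {z. N ((h - r) *\<^sub>R v + r *\<^sub>R z) < t}"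
proof -
  \<comment> \<open>Either \<open>B(0, t)\<close> fits entirely and \<open>m = 0\<close>, or the
    ball has the diameter from \<open>(h - 2 r) v\<close> to \<open>t v\<close>.\<close>
  define \<rho> m where "\<rho> = min t ((t + 2 * r - h) / 2)" and "m = t - \<rho>"
  have r: "0 < r" using h by simp
  have \<rho>: "0 < \<rho>" "0 \<le> m" "m \<le> h - r" "\<rho> + (h - r) - m \<le> r" using h by (auto simp: \<rho>_def m_def min_def field_simps)
  \<comment> \<open>The ball around \<open>m v\<close>, pulled back by
    \<open>z \<mapsto> (h - r) v + r z\<close>.\<close>
  define B where "B = norm_ball N (((m - (h - r)) / r) *\<^sub>R v) (\<rho> / r)"
  have B: "N z < 1 \<and> N ((h - r) *\<^sub>R v + r *\<^sub>R z) < t" if "z \<in> B" for z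
  proof -
    \<comment> \<open>The offset of the displacement from the center \<open>m v\<close>.\<close>
    define w where "w = r *\<^sub>R z - (m - (h - r)) *\<^sub>R v"
    have w_eq: "w = r *\<^sub>R (z - ((m - (h - r)) / r) *\<^sub>R v)" using r by (simp add: w_def scaleR_right_diff_distrib)
    have w: "N w < \<rho>"
      using that r unfolding w_eq scale
      by (simp add: B_def norm_ball_def pos_less_divide_eq mult.commute)
    have "N (r *\<^sub>R z) \<le> N w + N ((m - (h - r)) *\<^sub>R v)"
      using triangle[of w "(m - (h - r)) *\<^sub>R v"] by (simp add: w_def)
    also have "\<dots> < r" using w \<rho> by (simp add: scale v)
    finally have "N z < 1" using r by (simp add: scale)
    moreover have "(h - r) *\<^sub>R v + r *\<^sub>R z = m *\<^sub>R v + w" by (simp add: w_def algebra_simps)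
    then have "N ((h - r) *\<^sub>R v + r *\<^sub>R z) \<le> N (m *\<^sub>R v) + N w" using triangle by metis
    then have "N ((h - r) *\<^sub>R v + r *\<^sub>R z) < t" using w \<rho> by (simp add: scale v m_def)
    ultimately show ?thesis by simp
  qed
  have "B \<subseteq> norm_ball N 0 1" using B by (auto simp: norm_ball_def)
  then have "ennreal (overlap_fraction CARD('n) h r t) = emeasure unif B"
    unfolding B_def using r \<rho>
    by (subst emeasure_unif_ball(1)) (simp_all add: overlap_fraction_def \<rho>_def[symmetric])
  also have "\<dots> \<le> emeasure unif {z. N ((h - r) *\<^sub>R v + r *\<^sub>R z) < t}"
    using B by (intro emeasure_mono) auto
  finally show ?thesis .
qed

text \<open>Level by level, \<open>overlap_fraction_le\<close> bounds the distribution function from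
  below and therefore the tail from above.\<close>

lemma displacement_le:
  assumes m: "modulus_of_continuity \<omega>" and h: "0 < h" "h / 2 \<le> r" "r \<le> h" and v: "N v = 1"
  shows "(\<integral>\<^sup>+z. ennreal (\<omega> (N ((h - r) *\<^sub>R v + r *\<^sub>R z))) \<partial>unif) \<le> mean_displacement CARD('n) \<omega> h r"
proof -
  have r: "0 < r" using h by simp
  define X where "X z = \<omega> (N ((h - r) *\<^sub>R v + r *\<^sub>R z))" for z
  have X[measurable]: "X \<in> borel_measurable borel"
    unfolding X_def
    by (intro borel_measurable_continuous_onI continuous_on_compose2[OF modulus_N_continuous(1)[OF m, of UNIV]]
        continuous_intros) auto
  have "(\<integral>\<^sup>+z. ennreal (X z) \<partial>unif) = (\<integral>\<^sup>+l\<in>{0<..}. emeasure unif {z. l \<le> X z} \<partial>lborel)"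
    by (subst nn_integral_layer_cake[OF sigma_finite_unif]) auto
  also have "\<dots> \<le> mean_displacement CARD('n) \<omega> h r"
    unfolding mean_displacement_def
  proof (intro nn_integral_mono)
    fix l :: real
    consider "l \<le> 0" | "0 < l" "l \<le> \<omega> h" | "0 < l" "\<omega> h < l" by linarith
    then show "emeasure unif {z. l \<le> X z} * indicator {0<..} l
      \<le> ennreal (1 - overlap_fraction CARD('n) h r (modulus_inverse \<omega> l)) * indicator {0<..\<omega> h} l"
    proof cases
      case 2
      define t where "t = modulus_inverse \<omega> l"
      have t: "0 < t" "t \<le> h" "\<And>s. 0 \<le> s \<Longrightarrow> l \<le> \<omega> s \<longleftrightarrow> t \<le> s"
        using modulus_inverse[OF m less_imp_le[OF h(1)] 2] by (auto simp: t_def)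
      have F: "0 \<le> overlap_fraction CARD('n) h r t" using t h by (simp add: overlap_fraction_def)
      have "{z. X z < l} = {z. N ((h - r) *\<^sub>R v + r *\<^sub>R z) < t}"
        using t(3) by (auto simp: X_def not_le[symmetric])
      then have "ennreal (overlap_fraction CARD('n) h r t) \<le> emeasure unif {z. X z < l}"
        using overlap_fraction_le[OF t(1,2) h(2,3) v] by simp
      then have "emeasure unif {z. l \<le> X z} \<le> 1 - ennreal (overlap_fraction CARD('n) h r t)"
        by (subst emeasure_unif_Collect_ge) (auto intro: ennreal_minus_mono)
      also have "\<dots> = ennreal (1 - overlap_fraction CARD('n) h r t)"
        using F by (metis ennreal_1 ennreal_minus)
      finally show ?thesis using 2 by (simp add: t_def)
    next
      case 3
      \<comment> \<open>Levels above \<open>\<omega> h\<close> carry no mass, since the displacement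
        has norm at most \<open>(h - r) + r = h\<close> on the unit ball.\<close>
      have "emeasure unif {z. l \<le> X z} \<le> emeasure unif {}"
      proof (rule emeasure_unif_mono)
        fix z assume z: "z \<in> {z. l \<le> X z}" "N z < 1"
        have "N ((h - r) *\<^sub>R v + r *\<^sub>R z) \<le> (h - r) + r * N z"
          using triangle[of "(h - r) *\<^sub>R v" "r *\<^sub>R z"] h r v by (simp add: scale)
        also have "\<dots> \<le> h" using z(2) r by (simp add: mult_left_le)
        finally have "X z \<le> \<omega> h" unfolding X_def by (intro modulus_mono[OF m]) auto
        then show "z \<in> {}" using z 3 by simp
      qed simp
      then show ?thesis by simp
    qed simp
  qed
  finally show ?thesis by (simp add: X_def)
qed

lemma Lip_bound:
  assumes m: "modulus_of_continuity \<omega>" and f: "f \<in> Lip N \<omega>"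
  obtains L where "0 \<le> L" "lip_norm N \<omega> f = ennreal L" "\<And>x y. \<bar>f x - f y\<bar> \<le> L * \<omega> (N (x - y))"
proof -
  obtain L where L: "0 \<le> L" "lip_norm N \<omega> f = ennreal L"
    using f by (auto simp: Lip_def less_top elim: ennreal_cases)
  have "\<bar>f x - f y\<bar> \<le> L * \<omega> (N (x - y))" for x y
  proof (cases "x = y")
    case True
    then show ?thesis by (simp add: modulus_0[OF m])
  next
    case False
    then have "ennreal (\<bar>f x - f y\<bar> / \<omega> (N (x - y))) \<le> ennreal L"
      unfolding L(2)[symmetric] lip_norm_def by (intro SUP_upper2[of "(x, y)"]) auto
    then show ?thesis using L False modulus_pos[OF m, of "N (x - y)"] by (simp add: field_simps)
  qed
  then show ?thesis using that L by blast
qed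

lemma Lip_continuous:
  assumes m: "modulus_of_continuity \<omega>" and f: "f \<in> Lip N \<omega>"
  shows "continuous_on UNIV f"
  unfolding continuous_on_iff
proof (intro ballI allI impI)
  fix x and \<epsilon> :: real assume \<epsilon>: "0 < \<epsilon>"
  obtain L where L: "0 \<le> L" "\<And>x y. \<bar>f x - f y\<bar> \<le> L * \<omega> (N (x - y))" using Lip_bound[OF m f] by metis
  obtain \<delta> where \<delta>: "0 < \<delta>" "\<And>t. 0 \<le> t \<Longrightarrow> t < \<delta> \<Longrightarrow> \<omega> t < \<epsilon> / (L + 1)"
    using modulus_tendsto_0[OF m, of "\<epsilon> / (L + 1)"] \<epsilon> L by auto
  obtain \<eta> where \<eta>: "0 < \<eta>" "\<And>x y. dist x y < \<eta> \<Longrightarrow> N (x - y) < \<delta>" using small_near[OF \<delta>(1)] by metis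
  have "dist (f y) (f x) < \<epsilon>" if "dist y x < \<eta>" for y
  proof -
    have "\<omega> (N (y - x)) < \<epsilon> / (L + 1)" using \<eta> \<delta> that by simp
    then have "(L + 1) * \<omega> (N (y - x)) < \<epsilon>" using L by (simp add: field_simps)
    moreover have "L * \<omega> (N (y - x)) \<le> (L + 1) * \<omega> (N (y - x))"
      using modulus_nonneg[OF m, of "N (y - x)"] by (intro mult_right_mono) auto
    ultimately show ?thesis using L(2)[of y x] by (simp add: dist_real_def)
  qed
  then show "\<exists>d>0. \<forall>x'\<in>UNIV. dist x' x < d \<longrightarrow> dist (f x') (f x) < \<epsilon>" using \<eta>(1) by blast
qed

lemma average_le_maximal:
  assumes "f \<in> borel_measurable borel" "0 < r" "N (x - c) < r"
  shows "(\<integral>\<^sup>+z. ennreal \<bar>f (c + r *\<^sub>R z)\<bar> \<partial>unif) \<le> maximal_function N f x"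
proof -
  have "(\<integral>\<^sup>+z. ennreal \<bar>f (c + r *\<^sub>R z)\<bar> \<partial>unif) =
    (\<integral>\<^sup>+y\<in>norm_ball N c r. ennreal \<bar>f y\<bar> \<partial>lebesgue) / emeasure lebesgue (norm_ball N c r)"
    using assms by (intro average_eq[symmetric]) auto
  also have "\<dots> \<le> maximal_function N f x"
    unfolding maximal_function_def
    using assms by (intro SUP_upper[where i = "norm_ball N c r"]) (auto simp: norm_ball_def)
  finally show ?thesis .
qed

lemma maximal_leI:
  assumes "f \<in> borel_measurable borel"
    and "\<And>c r. 0 < r \<Longrightarrow> N (x - c) < r \<Longrightarrow> (\<integral>\<^sup>+z. ennreal \<bar>f (c + r *\<^sub>R z)\<bar> \<partial>unif) \<le> M"
  shows "maximal_function N f x \<le> M"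
  unfolding maximal_function_def
proof (intro SUP_least)
  fix B assume "B \<in> {norm_ball N c r |c r. 0 < r \<and> x \<in> norm_ball N c r}"
  then obtain c r where "B = norm_ball N c r" "0 < r" "N (x - c) < r" by (auto simp: norm_ball_def)
  then show "(\<integral>\<^sup>+y\<in>B. ennreal \<bar>f y\<bar> \<partial>lebesgue) / emeasure lebesgue B \<le> M"
    using average_eq[of "\<lambda>y. ennreal \<bar>f y\<bar>" r c] assms by simp
qed

lemma maximal_function_le:
  assumes m: "modulus_of_continuity \<omega>" and f: "f \<in> Lip N \<omega>"
    and h: "h = N (x - y)" "0 < h" "h / 2 \<le> r" "r \<le> h"
  shows "maximal_function N f x \<le>
    maximal_function N f y + lip_norm N \<omega> f * mean_displacement CARD('n) \<omega> h r"
proof -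
  have f_borel[measurable]: "f \<in> borel_measurable borel"
    using Lip_continuous[OF m f] by (rule borel_measurable_continuous_onI)
  obtain L where L: "0 \<le> L" "lip_norm N \<omega> f = ennreal L" "\<And>x y. \<bar>f x - f y\<bar> \<le> L * \<omega> (N (x - y))"
    using Lip_bound[OF m f] by metis
  show ?thesis
  proof (rule maximal_leI[OF f_borel])
    fix c \<rho> assume \<rho>: "0 < (\<rho>::real)" "N (x - c) < \<rho>"
    show "(\<integral>\<^sup>+z. ennreal \<bar>f (c + \<rho> *\<^sub>R z)\<bar> \<partial>unif) \<le>
      maximal_function N f y + lip_norm N \<omega> f * mean_displacement CARD('n) \<omega> h r"
    proof (cases "N (y - c) < \<rho>")
      \<comment> \<open>This ball also contains \<open>y\<close>, so its average already competes in
        the supremum at \<open>y\<close>.\<close>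
      case True
      then show ?thesis using average_le_maximal[OF f_borel \<rho>(1), of y c] by (simp add: add_increasing2)
    next
      case False
      define k v where "k = N (y - c)" and "v = (1 / k) *\<^sub>R (y - c)"
      have k: "0 < k" "\<rho> \<le> k" "k < \<rho> + h"
        using False \<rho> triangle_diff[of y c x] h(1) minus_commute[of x y] by (auto simp: k_def)
      have v: "N v = 1" "k *\<^sub>R v = y - c" using k by (simp_all add: v_def scale) (simp add: k_def)
      \<comment> \<open>The new ball contains \<open>y\<close>: \<open>k < \<rho> + h\<close> gives
        \<open>k - (h - r) < \<rho> + r\<close>, and \<open>h \<le> 2 r\<close> with
        \<open>k > 0\<close> gives \<open>(h - r) - k < r\<close>.\<close>
      have "y - (c + (h - r) *\<^sub>R v) = (k - (h - r)) *\<^sub>R v"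
        using v by (simp add: algebra_simps)
      then have y: "N (y - (c + (h - r) *\<^sub>R v)) < \<rho> + r"
        using k h \<rho> by (simp add: scale v)
      have c1: "continuous_on UNIV (\<lambda>z. \<omega> (N ((h - r) *\<^sub>R v + r *\<^sub>R z)))"
        by (intro continuous_on_compose2[OF modulus_N_continuous(1)[OF m, of UNIV]] continuous_intros) auto
      have [measurable]: "(\<lambda>z. \<omega> (N ((h - r) *\<^sub>R v + r *\<^sub>R z))) \<in> borel_measurable borel"
        by (rule borel_measurable_continuous_onI[OF c1])
      have "(\<integral>\<^sup>+z. ennreal \<bar>f (c + \<rho> *\<^sub>R z)\<bar> \<partial>unif) \<le>
        (\<integral>\<^sup>+z. ennreal \<bar>f ((c + (h - r) *\<^sub>R v) + (\<rho> + r) *\<^sub>R z)\<bar> +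
          ennreal L * ennreal (\<omega> (N ((h - r) *\<^sub>R v + r *\<^sub>R z))) \<partial>unif)"
      proof (intro nn_integral_mono)
        fix z
        \<comment> \<open>The points of the two balls with the same parameter \<open>z\<close>;
          their difference is the displacement treated in \<open>displacement_le\<close>.\<close>
        define a b where "a = c + \<rho> *\<^sub>R z" and "b = (c + (h - r) *\<^sub>R v) + (\<rho> + r) *\<^sub>R z"
        have "b - a = (h - r) *\<^sub>R v + r *\<^sub>R z" by (simp add: a_def b_def algebra_simps)
        then have "\<bar>f b - f a\<bar> \<le> L * \<omega> (N ((h - r) *\<^sub>R v + r *\<^sub>R z))" using L(3)[of b a] by simp
        then have "\<bar>f a\<bar> \<le> \<bar>f b\<bar> + L * \<omega> (N ((h - r) *\<^sub>R v + r *\<^sub>R z))" by linarith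
        then show "ennreal \<bar>f (c + \<rho> *\<^sub>R z)\<bar> \<le> ennreal \<bar>f ((c + (h - r) *\<^sub>R v) + (\<rho> + r) *\<^sub>R z)\<bar> +
          ennreal L * ennreal (\<omega> (N ((h - r) *\<^sub>R v + r *\<^sub>R z)))"
          using L modulus_nonneg[OF m, of "N ((h - r) *\<^sub>R v + r *\<^sub>R z)"]
          by (simp add: a_def[symmetric] b_def[symmetric] ennreal_mult[symmetric] ennreal_plus[symmetric]
              ennreal_leI del: ennreal_plus)
      qed
      also have "\<dots> = (\<integral>\<^sup>+z. ennreal \<bar>f ((c + (h - r) *\<^sub>R v) + (\<rho> + r) *\<^sub>R z)\<bar> \<partial>unif) +
          ennreal L * (\<integral>\<^sup>+z. ennreal (\<omega> (N ((h - r) *\<^sub>R v + r *\<^sub>R z))) \<partial>unif)"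
        by (simp add: nn_integral_add nn_integral_cmult)
      also have "\<dots> \<le> maximal_function N f y + lip_norm N \<omega> f * mean_displacement CARD('n) \<omega> h r"
        unfolding L(2) using y k h \<rho>
        by (intro add_mono mult_left_mono average_le_maximal displacement_le m v) auto
      finally show ?thesis .
    qed
  qed
qed

theorem maximal_op_norm_le:
  assumes m: "modulus_of_continuity \<omega>"
  shows "maximal_op_norm N \<omega> \<le> extremal_const CARD('n) \<omega>"
  unfolding maximal_op_norm_def
proof (intro SUP_least)
  fix f assume "f \<in> {f \<in> Lip N \<omega>. lip_norm N \<omega> f \<noteq> 0}"
  then have f: "f \<in> Lip N \<omega>" and f0: "lip_norm N \<omega> f \<noteq> 0" by auto
  obtain L where L: "0 \<le> L" "lip_norm N \<omega> f = ennreal L" using Lip_bound[OF m f] by metis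
  with f0 have L0: "0 < L" by (cases "L = 0") auto
  define K where "K = extremal_const CARD('n) \<omega>"
  let ?M = "maximal_function N f"
  have le: "?M x \<le> ?M y + ennreal L * mean_displacement CARD('n) \<omega> (N (x - y)) r"
    if "x \<noteq> y" "N (x - y) / 2 \<le> r" "r \<le> N (x - y)" for x y r
    using maximal_function_le[OF m f refl _ that(2,3)] that(1) unfolding L(2) by simp
  \<comment> \<open>The choice \<open>r = N (x - y)\<close> has a finite bound, so finiteness at one
    point spreads to all. Hence the maximal function is infinite everywhere or nowhere.\<close>
  have fin: "?M x < \<infinity>" if "?M y < \<infinity>" for x y
  proof (cases "x = y")
    case False
    have "mean_displacement CARD('n) \<omega> (N (x - y)) (N (x - y)) \<le> ennreal (\<omega> (N (x - y)))"
      by (intro mean_displacement_le m) auto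
    then have "?M y + ennreal L * mean_displacement CARD('n) \<omega> (N (x - y)) (N (x - y)) < \<infinity>"
      using that by (auto simp: ennreal_mult_less_top intro: le_less_trans)
    then show ?thesis using le[OF False, of "N (x - y)"] by (auto intro: le_less_trans)
  qed (use that in simp)
  have "ext_lip_norm N \<omega> ?M \<le> lip_norm N \<omega> f * K"
  proof (cases "\<exists>x. ?M x = \<infinity>")
    case True
    then have "\<forall>x. ?M x = \<infinity>" using fin by (metis infinity_ennreal_def less_top)
    then show ?thesis by (simp add: ext_lip_norm_def)
  next
    case False
    then have Mr: "ennreal (enn2real (?M x)) = ?M x" for x by (simp add: less_top)
    \<comment> \<open>One-sided; the absolute value follows by exchanging \<open>x\<close> and
      \<open>y\<close>.\<close>
    have diff: "ennreal ((enn2real (?M x) - enn2real (?M y)) / \<omega> (N (x - y))) \<le> ennreal L * K"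
      if xy: "x \<noteq> y" for x y
    proof -
      define h where "h = N (x - y)"
      have h: "0 < h" using xy by (simp add: h_def)
      have \<omega>: "0 < \<omega> h" by (rule modulus_pos[OF m h])
      \<comment> \<open>Normalized by \<open>L\<close>, the difference is compared with each
        \<open>mean_displacement\<close> separately and then with their infimum. If \<open>a\<close>
        is negative, \<open>ennreal a\<close> is 0.\<close>
      define a where "a = (enn2real (?M x) - enn2real (?M y)) / L"
      obtain D where D: "0 \<le> D" "(INF r\<in>{h / 2..h}. mean_displacement CARD('n) \<omega> h r) = ennreal D"
        using INF_mean_displacement_finite[OF m h] by metis
      have "ennreal a \<le> (INF r\<in>{h / 2..h}. mean_displacement CARD('n) \<omega> h r)"
      proof (intro INF_greatest)
        fix r assume r: "r \<in> {h / 2..h}"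
        have "mean_displacement CARD('n) \<omega> h r \<le> ennreal (\<omega> h)"
          using r h by (intro mean_displacement_le m) auto
        then obtain j where j: "0 \<le> j" "mean_displacement CARD('n) \<omega> h r = ennreal j"
          by (metis ennreal_cases ennreal_neq_top top_unique)
        have "ennreal (enn2real (?M x)) \<le> ennreal (enn2real (?M y)) + ennreal L * ennreal j"
          using le[OF xy, of r] r j unfolding Mr h_def[symmetric] by simp
        then have "enn2real (?M x) \<le> enn2real (?M y) + L * j"
          using L(1) j(1) by (simp add: ennreal_mult[symmetric] ennreal_plus[symmetric] del: ennreal_plus)
        then have "a \<le> j" using L0 by (simp add: a_def field_simps)
        then show "ennreal a \<le> mean_displacement CARD('n) \<omega> h r" unfolding j(2) by (rule ennreal_leI)
      qed
      then have aD: "a \<le> D" using D by simp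
      have "ennreal ((enn2real (?M x) - enn2real (?M y)) / \<omega> h) = ennreal (L * (a / \<omega> h))"
        using L0 by (simp add: a_def)
      also have "\<dots> \<le> ennreal (L * (D / \<omega> h))"
        using aD L \<omega> by (intro ennreal_leI mult_left_mono divide_right_mono) auto
      also have "\<dots> = ennreal L * (ennreal D / ennreal (\<omega> h))"
        using D(1) L(1) \<omega> by (subst divide_ennreal) (auto simp: ennreal_mult[symmetric])
      also have "\<dots> \<le> ennreal L * K"
        unfolding K_def extremal_const_def D(2)[symmetric] using h
        by (intro mult_left_mono SUP_upper) auto
      finally show ?thesis by (simp add: h_def)
    qed
    have "lip_norm N \<omega> (\<lambda>x. enn2real (?M x)) \<le> ennreal L * K"
      unfolding lip_norm_def
    proof (intro SUP_least, clarify)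
      fix x y :: "real ^ 'n" assume "x \<noteq> y"
      then show "ennreal (\<bar>enn2real (?M x) - enn2real (?M y)\<bar> / \<omega> (N (x - y))) \<le> ennreal L * K"
        using diff[of x y] diff[of y x] by (auto simp: abs_if minus_commute[of y x])
    qed
    then show ?thesis using False L(2) by (auto simp: ext_lip_norm_def)
  qed
  then show "ext_lip_norm N \<omega> ?M / lip_norm N \<omega> f \<le> K"
    using f0 by (intro divide_le_posI_ennreal) (auto simp: zero_less_iff_neq_zero)
qed

end

section \<open>The lower bound, for norms whose balls intersect in balls\<close>

text \<open>
  If neither of the balls \<open>B(0, t)\<close> and \<open>B(h e, q)\<close> contains the other, assumption \<open>ball_Int\<close> says that
  their intersection is the ball with diameter from \<open>(h - q) e\<close> to \<open>t e\<close>.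
\<close>

locale extremal_norm = vector_norm N for N :: "real ^ 'n \<Rightarrow> real" +
  fixes e :: "real ^ 'n"
  assumes N_e: "N e = 1"
    and ball_Int: "N u < t \<Longrightarrow> N (u - h *\<^sub>R e) < q \<Longrightarrow>
      N (u - ((t + h - q) / 2) *\<^sub>R e) < (t + q - h) / 2"
begin

text \<open>Converse of \<open>overlap_fraction_le\<close> along the axis of \<open>e\<close>: the
  part of \<open>B(c, r)\<close> inside \<open>B(0, t)\<close> is confined by
  \<open>ball_Int\<close> to a ball of radius \<open>\<rho>\<close>. Clamping \<open>r\<close> to
  \<open>[h/2, h]\<close> can only increase the bound on the share.\<close>

lemma emeasure_le_overlap_fraction:
  assumes t: "0 < t" "t \<le> h" and r: "0 < r" "N (h *\<^sub>R e - c) < r"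
  defines "r' \<equiv> max (h / 2) (min h r)"
  shows "emeasure unif {z. N (c + r *\<^sub>R z) < t} \<le> ennreal (overlap_fraction CARD('n) h r' t)"
proof -
  define \<rho> where "\<rho> = min t ((t + 2 * r - h) / 2)"
  define m where "m = (if t \<le> (t + 2 * r - h) / 2 then 0 else (t + h - 2 * r) / 2)"
  have r': "0 < r'" using t by (simp add: r'_def)
  have in_ball: "N (c + r *\<^sub>R z - m *\<^sub>R e) < \<rho>" if "N (c + r *\<^sub>R z) < t" "N z < 1" for z
  proof -
    \<comment> \<open>A ball of radius \<open>r\<close> containing \<open>h e\<close> lies within
      distance \<open>2 r\<close> of it, so \<open>ball_Int\<close> applies with
      \<open>q = 2 r\<close>.\<close>
    have "N (c + r *\<^sub>R z - h *\<^sub>R e) \<le> N (r *\<^sub>R z) + N (c - h *\<^sub>R e)"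
      using triangle[of "r *\<^sub>R z" "c - h *\<^sub>R e"] by (simp add: algebra_simps)
    also have "\<dots> < 2 * r"
      using that r by (simp add: scale minus_commute[of c]) (smt (verit) mult_less_cancel_left2)
    finally show ?thesis using ball_Int[OF that(1), of h "2 * r"] that by (auto simp: m_def \<rho>_def min_def)
  qed
  \<comment> \<open>Outside \<open>[h/2, h]\<close> the right-hand side equals \<open>t / h\<close>,
    its value at both endpoints.\<close>
  have le: "\<rho> / r \<le> min t ((t + 2 * r' - h) / 2) / r'"
  proof -
    consider "h / 2 \<le> r" "r \<le> h" | "h < r" | "r < h / 2" by linarith
    then show ?thesis
    proof cases
      case 1
      then show ?thesis by (simp add: r'_def \<rho>_def)
    next
      case 2
      have "\<rho> / r \<le> t / r" using r by (simp add: \<rho>_def divide_right_mono)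
      also have "\<dots> \<le> t / h" using t 2 by (intro divide_left_mono) auto
      finally show ?thesis using t 2 by (simp add: r'_def min_def)
    next
      case 3
      have "\<rho> / r \<le> ((t + 2 * r - h) / 2) / r" using r by (intro divide_right_mono) (simp_all only: \<rho>_def min.cobounded2)
      also have "\<dots> \<le> t / h"
      proof -
        \<comment> \<open>This product is the numerator of
          \<open>t / h - (t + 2 r - h) / (2 r)\<close> over the denominator
          \<open>2 r h\<close>.\<close>
        have "0 \<le> (h - t) * (h - 2 * r)" using t 3 by simp
        then show ?thesis using t r by (simp add: field_simps)
      qed
      finally show ?thesis using t 3 by (simp add: r'_def min_def)
    qed
  qed
  show ?thesis
  proof (cases "0 < \<rho>")
    case True
    have "emeasure unif {z. N (c + r *\<^sub>R z) < t} \<le> emeasure unif (norm_ball N ((1 / r) *\<^sub>R (m *\<^sub>R e - c)) (\<rho> / r))"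
    proof (rule emeasure_unif_mono)
      fix z assume "z \<in> {z. N (c + r *\<^sub>R z) < t}" "N z < 1"
      then have "N (c + r *\<^sub>R z - m *\<^sub>R e) < \<rho>" using in_ball by simp
      moreover have eq: "c + r *\<^sub>R z - m *\<^sub>R e = r *\<^sub>R (z - (1 / r) *\<^sub>R (m *\<^sub>R e - c))"
        using r by (simp add: scaleR_right_diff_distrib)
      ultimately show "z \<in> norm_ball N ((1 / r) *\<^sub>R (m *\<^sub>R e - c)) (\<rho> / r)"
        using r unfolding eq scale by (simp add: norm_ball_def pos_less_divide_eq mult.commute)
    qed simp
    also have "\<dots> \<le> ennreal ((\<rho> / r) ^ CARD('n))" using True r by (intro emeasure_unif_ball(2)) simp
    also have "\<dots> \<le> ennreal (overlap_fraction CARD('n) h r' t)"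
      unfolding overlap_fraction_def using True r le by (intro ennreal_leI power_mono) auto
    finally show ?thesis .
  next
    case False
    \<comment> \<open>With \<open>\<rho> \<le> 0\<close> no point of \<open>B(c, r)\<close> lies in
      \<open>B(0, t)\<close>.\<close>
    have "emeasure unif {z. N (c + r *\<^sub>R z) < t} \<le> emeasure unif {}"
    proof (rule emeasure_unif_mono)
      fix z assume "z \<in> {z. N (c + r *\<^sub>R z) < t}" "N z < 1"
      then have "N (c + r *\<^sub>R z - m *\<^sub>R e) < \<rho>" using in_ball by simp
      then show "z \<in> {}" using False nonneg[of "c + r *\<^sub>R z - m *\<^sub>R e"] by linarith
    qed simp
    then show ?thesis by simp
  qed
qed

text \<open>Counterpart of \<open>displacement_le\<close> for an arbitrary ball containing
  \<open>h e\<close>: the clamped radius \<open>r'\<close> is a witness for the infimum, compared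
  level by level through the layer cake formula.\<close>

lemma mean_displacement_le_average:
  assumes m: "modulus_of_continuity \<omega>" and h: "0 < h" and r: "0 < r" "N (h *\<^sub>R e - c) < r"
  shows "(INF r\<in>{h / 2..h}. mean_displacement CARD('n) \<omega> h r)
    \<le> (\<integral>\<^sup>+z. ennreal (\<omega> (min (N (c + r *\<^sub>R z)) h)) \<partial>unif)"
proof (rule INF_lower2)
  define r' where "r' = max (h / 2) (min h r)"
  show "r' \<in> {h / 2..h}" using h by (auto simp: r'_def)
  define X where "X z = \<omega> (min (N (c + r *\<^sub>R z)) h)" for z
  have X[measurable]: "X \<in> borel_measurable borel"
    unfolding X_def using h
    by (intro borel_measurable_continuous_onI continuous_on_compose2[OF modulus_N_continuous(2)[OF m, of h UNIV]]
        continuous_intros) auto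
  have "mean_displacement CARD('n) \<omega> h r' \<le> (\<integral>\<^sup>+l\<in>{0<..}. emeasure unif {z. l \<le> X z} \<partial>lborel)"
    unfolding mean_displacement_def
  proof (intro nn_integral_mono)
    fix l :: real
    show "ennreal (1 - overlap_fraction CARD('n) h r' (modulus_inverse \<omega> l)) * indicator {0<..\<omega> h} l
      \<le> emeasure unif {z. l \<le> X z} * indicator {0<..} l"
    proof (cases "l \<in> {0<..\<omega> h}")
      case True
      define t where "t = modulus_inverse \<omega> l"
      have t: "0 < t" "t \<le> h" "\<And>s. 0 \<le> s \<Longrightarrow> l \<le> \<omega> s \<longleftrightarrow> t \<le> s"
        using modulus_inverse[OF m less_imp_le[OF h(1)], of l] True by (auto simp: t_def)
      have "0 < r'" using h by (simp add: r'_def)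
      then have F: "0 \<le> overlap_fraction CARD('n) h r' t"
        using t by (auto simp: overlap_fraction_def r'_def intro!: zero_le_power)
      \<comment> \<open>Since \<open>t \<le> h\<close>, truncating the norm at \<open>h\<close> does
        not change the event.\<close>
      have "{z. X z < l} = {z. N (c + r *\<^sub>R z) < t}"
        using t h by (auto simp: X_def not_le[symmetric])
      then have "emeasure unif {z. X z < l} \<le> ennreal (overlap_fraction CARD('n) h r' t)"
        using emeasure_le_overlap_fraction[OF t(1,2) r] by (simp add: r'_def)
      then have "1 - ennreal (overlap_fraction CARD('n) h r' t) \<le> emeasure unif {z. l \<le> X z}"
        by (subst emeasure_unif_Collect_ge) (auto intro: ennreal_minus_mono)
      then show ?thesis using True F by (simp add: t_def[symmetric]) (metis ennreal_1 ennreal_minus)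
    qed simp
  qed
  also have "\<dots> = (\<integral>\<^sup>+z. ennreal (X z) \<partial>unif)"
    by (subst nn_integral_layer_cake[OF sigma_finite_unif]) auto
  finally show "mean_displacement CARD('n) \<omega> h r' \<le> (\<integral>\<^sup>+z. ennreal (\<omega> (min (N (c + r *\<^sub>R z)) h)) \<partial>unif)"
    by (simp add: X_def)
qed

theorem extremal_const_le:
  assumes m: "modulus_of_continuity \<omega>"
  shows "extremal_const CARD('n) \<omega> \<le> maximal_op_norm N \<omega>"
  unfolding extremal_const_def
proof (intro SUP_least)
  fix h :: real assume "h \<in> {0<..}"
  then have h: "0 < h" by simp
  have \<omega>h: "0 < \<omega> h" by (rule modulus_pos[OF m h])
  define X where "X z = \<omega> (min (N z) h)" for z
  define f where "f z = \<omega> h - X z" for z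
  have X: "0 \<le> X z" "X z \<le> \<omega> h" for z
    using h unfolding X_def by (auto intro!: modulus_nonneg[OF m] modulus_mono[OF m])
  have f: "0 \<le> f z" "f z \<le> \<omega> h" for z using X[of z] by (auto simp: f_def)
  have X_cont: "continuous_on UNIV X"
    unfolding X_def using modulus_N_continuous(2)[OF m, of h] h by simp
  have X_borel[measurable]: "X \<in> borel_measurable borel"
    using X_cont by (rule borel_measurable_continuous_onI)
  have f_borel[measurable]: "f \<in> borel_measurable borel" unfolding f_def by measurable
  have N_he: "N (h *\<^sub>R e) = h" using h by (simp add: scale N_e)
  have he: "h *\<^sub>R e \<noteq> 0" using N_he h by auto
  have f0: "f 0 = \<omega> h" and fhe: "f (h *\<^sub>R e) = 0"
    using h N_he by (simp_all add: f_def X_def modulus_0[OF m])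
  \<comment> \<open>Truncation at \<open>h\<close> is nonexpansive, so the Lipschitz norm is at most
    1; the pair \<open>0\<close>, \<open>h e\<close> shows that it is 1.\<close>
  have "\<bar>f x - f y\<bar> \<le> \<omega> (N (x - y))" for x y
  proof -
    have "\<bar>f x - f y\<bar> \<le> \<omega> \<bar>min (N x) h - min (N y) h\<bar>"
      using modulus_diff_le[OF m, of "min (N x) h" "min (N y) h"] h
      by (simp add: f_def X_def abs_minus_commute)
    also have "\<dots> \<le> \<omega> (N (x - y))"
      using reverse_triangle[of x y] by (intro modulus_mono[OF m]) (auto simp: min_def)
    finally show ?thesis .
  qed
  then have "lip_norm N \<omega> f \<le> 1"
    unfolding lip_norm_def using modulus_pos[OF m]
    by (intro SUP_least) (auto simp: ennreal_le_1 divide_le_eq_1)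
  moreover have "1 \<le> lip_norm N \<omega> f"
    unfolding lip_norm_def using he f0 fhe \<omega>h N_he
    by (intro SUP_upper2[of "(0, h *\<^sub>R e)"]) auto
  ultimately have lip1: "lip_norm N \<omega> f = 1" by (rule antisym)
  obtain D where D: "0 \<le> D" "(INF r\<in>{h / 2..h}. mean_displacement CARD('n) \<omega> h r) = ennreal D"
    using INF_mean_displacement_finite[OF m h] by metis
  let ?M = "maximal_function N f"
  have M_le: "?M x \<le> ennreal (\<omega> h)" for x
  proof (rule maximal_leI[OF f_borel])
    fix c r
    have "(\<integral>\<^sup>+z. ennreal \<bar>f (c + r *\<^sub>R z)\<bar> \<partial>unif) \<le> (\<integral>\<^sup>+z. ennreal (\<omega> h) \<partial>unif)"
      using f by (intro nn_integral_mono ennreal_leI) simp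
    then show "(\<integral>\<^sup>+z. ennreal \<bar>f (c + r *\<^sub>R z)\<bar> \<partial>unif) \<le> ennreal (\<omega> h)" by simp
  qed
  have M_he: "?M (h *\<^sub>R e) \<le> ennreal (\<omega> h) - ennreal D"
  proof (rule maximal_leI[OF f_borel])
    fix c r assume r: "0 < r" "N (h *\<^sub>R e - c) < r"
    have [measurable]: "(\<lambda>z. f (c + r *\<^sub>R z)) \<in> borel_measurable borel"
      "(\<lambda>z. X (c + r *\<^sub>R z)) \<in> borel_measurable borel" by measurable
    \<comment> \<open>As \<open>f + X\<close> is the constant \<open>\<omega> h\<close>, a mean of
      \<open>X\<close> of at least \<open>D\<close> costs the average of \<open>f\<close> at least
      \<open>D\<close>. The estimate is kept additive until the end because subtraction on
      \<open>ennreal\<close> truncates.\<close>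
    have "(\<integral>\<^sup>+z. ennreal \<bar>f (c + r *\<^sub>R z)\<bar> \<partial>unif) + ennreal D \<le>
      (\<integral>\<^sup>+z. ennreal \<bar>f (c + r *\<^sub>R z)\<bar> \<partial>unif) + (\<integral>\<^sup>+z. ennreal (X (c + r *\<^sub>R z)) \<partial>unif)"
      unfolding D(2)[symmetric] X_def using mean_displacement_le_average[OF m h r] by (rule add_left_mono)
    also have "\<dots> = (\<integral>\<^sup>+z. ennreal \<bar>f (c + r *\<^sub>R z)\<bar> + ennreal (X (c + r *\<^sub>R z)) \<partial>unif)"
      by (simp add: nn_integral_add)
    also have "\<dots> = (\<integral>\<^sup>+z. ennreal (\<omega> h) \<partial>unif)"
      using X f by (intro nn_integral_cong) (simp add: ennreal_plus[symmetric] f_def del: ennreal_plus)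
    finally have "(\<integral>\<^sup>+z. ennreal \<bar>f (c + r *\<^sub>R z)\<bar> \<partial>unif) + ennreal D \<le> ennreal (\<omega> h)" by simp
    then show "(\<integral>\<^sup>+z. ennreal \<bar>f (c + r *\<^sub>R z)\<bar> \<partial>unif) \<le> ennreal (\<omega> h) - ennreal D"
      by (metis add_diff_self_ennreal add.commute ennreal_add_left_cancel_le ennreal_neq_top
          ennreal_le_minus_iff)
  qed
  \<comment> \<open>Small balls around \<open>0\<close> have averages close to
    \<open>f 0 = \<omega> h\<close>, the maximum of \<open>f\<close>.\<close>
  have M_0: "?M 0 = ennreal (\<omega> h)"
  proof (rule antisym[OF M_le], rule ennreal_le_epsilon)
    fix \<epsilon> :: real assume \<epsilon>: "0 < \<epsilon>"
    obtain \<delta> where \<delta>: "0 < \<delta>" "\<And>t. 0 \<le> t \<Longrightarrow> t < \<delta> \<Longrightarrow> \<omega> t < \<epsilon>"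
      using modulus_tendsto_0[OF m \<epsilon>] by metis
    have "ennreal (\<omega> h) = (\<integral>\<^sup>+z. ennreal (\<omega> h) \<partial>unif)" by simp
    also have "\<dots> \<le> (\<integral>\<^sup>+z. ennreal \<bar>f (0 + \<delta> *\<^sub>R z)\<bar> + ennreal \<epsilon> \<partial>unif)"
    proof (rule nn_integral_mono_AE, use AE_unif in eventually_elim)
      fix z assume "N z < 1"
      then have "N (\<delta> *\<^sub>R z) < \<delta>" using \<delta> by (simp add: scale)
      then have "\<omega> (min (N (\<delta> *\<^sub>R z)) h) < \<epsilon>" using h by (intro \<delta>(2)) auto
      then have "\<omega> h \<le> \<bar>f (0 + \<delta> *\<^sub>R z)\<bar> + \<epsilon>" by (simp add: f_def X_def)
      then show "ennreal (\<omega> h) \<le> ennreal \<bar>f (0 + \<delta> *\<^sub>R z)\<bar> + ennreal \<epsilon>"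
        using \<epsilon> by (simp add: ennreal_plus[symmetric] ennreal_leI del: ennreal_plus)
    qed
    also have "\<dots> = (\<integral>\<^sup>+z. ennreal \<bar>f (0 + \<delta> *\<^sub>R z)\<bar> \<partial>unif) + ennreal \<epsilon>"
      by (simp add: nn_integral_add)
    also have "\<dots> \<le> ?M 0 + ennreal \<epsilon>"
      using \<delta>(1) by (intro add_right_mono average_le_maximal f_borel) auto
    finally show "ennreal (\<omega> h) \<le> ?M 0 + ennreal \<epsilon>" .
  qed
  have "D \<le> \<bar>enn2real (?M 0) - enn2real (?M (h *\<^sub>R e))\<bar>"
  proof -
    have "ennreal D \<le> ennreal (\<omega> h)"
      unfolding D(2)[symmetric] using h by (intro INF_lower2[of h] mean_displacement_le m) auto
    then have "D \<le> \<omega> h" using \<omega>h by simp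
    moreover have "?M (h *\<^sub>R e) \<le> ennreal (\<omega> h - D)" using M_he D by (simp add: ennreal_minus)
    ultimately have "enn2real (?M (h *\<^sub>R e)) \<le> \<omega> h - D" by (intro enn2real_leI) auto
    then show ?thesis using M_0 \<omega>h by simp
  qed
  then have "ennreal (D / \<omega> h) \<le> lip_norm N \<omega> (\<lambda>x. enn2real (?M x))"
    unfolding lip_norm_def using he N_he \<omega>h
    by (intro SUP_upper2[of "(0, h *\<^sub>R e)"]) (auto intro!: ennreal_leI divide_right_mono)
  also have "\<dots> = ext_lip_norm N \<omega> ?M / lip_norm N \<omega> f"
  proof -
    have "?M x \<noteq> \<infinity>" for x using M_le[of x] by (auto simp: top_unique)
    then show ?thesis by (simp add: ext_lip_norm_def lip1 divide_ennreal_def)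
  qed
  also have "\<dots> \<le> maximal_op_norm N \<omega>"
    unfolding maximal_op_norm_def using lip1 by (intro SUP_upper) (simp add: Lip_def)
  finally show "(INF r\<in>{h / 2..h}. mean_displacement CARD('n) \<omega> h r) / ennreal (\<omega> h) \<le> maximal_op_norm N \<omega>"
    unfolding D(2) using D \<omega>h by (simp add: divide_ennreal)
qed

theorem maximal_op_norm_eq:
  "modulus_of_continuity \<omega> \<Longrightarrow> maximal_op_norm N \<omega> = extremal_const CARD('n) \<omega>"
  using maximal_op_norm_le extremal_const_le by (rule antisym)

end

section \<open>The two norms\<close>

text \<open>All three distances to points of the axis share the off-axis sum \<open>S\<close>. What
  remains is an intersection of two intervals of half-lengths \<open>t - S\<close> and
  \<open>q - S\<close> in coordinate \<open>k\<close>, which has half-length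
  \<open>(t + q - h) / 2 - S\<close>.\<close>

lemma l1norm_extremal:
  "extremal_norm (l1norm :: real ^ 'n \<Rightarrow> real) (axis k 1)"
proof
  show "l1norm (x + y) \<le> l1norm x + l1norm y" for x y :: "real ^ 'n"
    unfolding l1norm_def sum.distrib[symmetric] by (intro sum_mono) auto
  show "l1norm (a *\<^sub>R x) = \<bar>a\<bar> * l1norm x" for a and x :: "real ^ 'n"
    by (simp add: l1norm_def abs_mult sum_distrib_left)
  have "l1norm x \<le> real CARD('n) * norm x" for x :: "real ^ 'n"
    unfolding l1norm_def using sum_mono[of UNIV "\<lambda>i. \<bar>x $ i\<bar>" "\<lambda>_. norm x"]
    by (simp add: component_le_norm_cart)
  then show "\<exists>C. \<forall>x :: real ^ 'n. l1norm x \<le> C * norm x" by blast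
  show "\<exists>C. \<forall>x :: real ^ 'n. norm x \<le> C * l1norm x"
    using norm_le_l1_cart by (intro exI[of _ 1]) (auto simp: l1norm_def)
  have split: "l1norm (u - h *\<^sub>R axis k 1) = \<bar>u $ k - h\<bar> + (\<Sum>i\<in>UNIV - {k}. \<bar>u $ i\<bar>)"
    for u :: "real ^ 'n" and h
    unfolding l1norm_def by (subst sum.remove[of _ k]) (auto simp: axis_def intro!: sum.cong)
  show "l1norm (axis k 1 :: real ^ 'n) = 1"
    using split[of "axis k 1" 0] by (simp add: axis_def)
  show "l1norm (u - ((t + h - q) / 2) *\<^sub>R axis k 1) < (t + q - h) / 2"
    if "l1norm u < t" "l1norm (u - h *\<^sub>R axis k 1) < q" for u :: "real ^ 'n" and t h q
  proof -
    define S where "S = (\<Sum>i\<in>UNIV - {k}. \<bar>u $ i\<bar>)"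
    have "\<bar>u $ k\<bar> < t - S" "\<bar>u $ k - h\<bar> < q - S"
      using that(1) that(2)[unfolded split] split[of u 0] by (simp_all add: S_def)
    then have "\<bar>u $ k - (t + h - q) / 2\<bar> < (t + q - h) / 2 - S"
      unfolding abs_less_iff by (simp add: field_simps)
    then show ?thesis unfolding split S_def[symmetric] by (simp only: less_diff_eq)
  qed
qed

text \<open>A supremum over finitely many coordinates is a maximum, so strict inequalities transfer
  both ways.\<close>

lemma infnorm_less_iff: "infnorm (x :: real ^ 'n) < t \<longleftrightarrow> (\<forall>i. \<bar>x $ i\<bar> < t)"
proof -
  have "infnorm x = Sup (range (\<lambda>i. \<bar>x $ i\<bar>))" unfolding infnorm_cart by (simp add: full_SetCompr_eq)
  also have "\<dots> = Max (range (\<lambda>i. \<bar>x $ i\<bar>))" by (rule cSup_eq_Max) auto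
  finally show ?thesis by (simp add: Max_less_iff)
qed

text \<open>Balls are cubes, and \<open>h 1\<close> has every coordinate equal to \<open>h\<close>.
  Each coordinate therefore sees the same intersection of two intervals, and the product of these
  intervals is a cube again.\<close>

lemma infnorm_extremal:
  "extremal_norm (infnorm :: real ^ 'n \<Rightarrow> real) 1"
proof
  show "infnorm (x + y) \<le> infnorm x + infnorm y" for x y :: "real ^ 'n" by (rule infnorm_triangle)
  show "infnorm (a *\<^sub>R x) = \<bar>a\<bar> * infnorm x" for a and x :: "real ^ 'n" by (rule infnorm_mul)
  show "\<exists>C. \<forall>x :: real ^ 'n. infnorm x \<le> C * norm x"
    using infnorm_le_norm by (intro exI[of _ 1]) auto
  show "\<exists>C. \<forall>x :: real ^ 'n. norm x \<le> C * infnorm x" using norm_le_infnorm by blast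
  show "infnorm (1 :: real ^ 'n) = 1"
    by (simp add: infnorm_cart)
  show "infnorm (u - ((t + h - q) / 2) *\<^sub>R 1) < (t + q - h) / 2"
    if "infnorm u < t" "infnorm (u - h *\<^sub>R 1) < q" for u :: "real ^ 'n" and t h q
    unfolding infnorm_less_iff
  proof
    fix i
    have "\<bar>u $ i\<bar> < t" "\<bar>u $ i - h\<bar> < q" using that by (auto simp: infnorm_less_iff)
    then show "\<bar>(u - ((t + h - q) / 2) *\<^sub>R 1) $ i\<bar> < (t + q - h) / 2"
      by (simp add: abs_if field_simps split: if_splits)
  qed
qed

theorem theorem3p17:
  fixes \<omega> :: "real \<Rightarrow> real"
  assumes "modulus_of_continuity \<omega>"
  shows "maximal_op_norm (l1norm :: real ^ 'n \<Rightarrow> real) \<omega> =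
         maximal_op_norm (infnorm :: real ^ 'n \<Rightarrow> real) \<omega>"
proof -
  have "maximal_op_norm (l1norm :: real ^ 'n \<Rightarrow> real) \<omega> = extremal_const CARD('n) \<omega>"
    by (rule extremal_norm.maximal_op_norm_eq[OF l1norm_extremal assms])
  also have "\<dots> = maximal_op_norm (infnorm :: real ^ 'n \<Rightarrow> real) \<omega>"
    by (rule extremal_norm.maximal_op_norm_eq[OF infnorm_extremal assms, symmetric])
  finally show ?thesis .
qed

end
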